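(* Let $\boldsymbol{x}:I\times\mathbb{R}\to H^3$ be the horocyclic surface given by $$\boldsymbol{x}(u,v)=\boldsymbol{a}_0(u)+v\boldsymbol{a}_1(u)+\frac{v^2}{2}(\boldsymbol{a}_0(u)+\boldsymbol{a}_2(u)).$$ Then $(\boldsymbol{x},\boldsymbol{\nu}_1,\boldsymbol{\nu}_2)$ is a hyperbolic generalized framed surface, where $$\boldsymbol{\nu}_1(u,v)=\boldsymbol{a}_3(u),\qquad \boldsymbol{\nu}_2(u,v)=-\frac{v^2}{2}\boldsymbol{a}_0(u)-v\boldsymbol{a}_1(u)+\Bigl(1-\frac{v^2}{2}\Bigr)\boldsymbol{a}_2(u),$$ with $$\alpha(u,v)=vh_1(u)-h_2(u)-vh_4(u),\qquad \beta(u,v)=\Bigl(1+\frac{v^2}{2}\Bigr)h_3(u)+vh_5(u)+\frac{v^2}{2}h_6(u)$$ and the basic invariants $a_1(u,v)=\bigl(1+\frac{v^2}{2}\bigr)h_3(u)+vh_5(u)+\frac{v^2}{2}h_6(u)$, $a_2(u,v)=0$, $b_1(u,v)=-vh_1(u)+h_2(u)+vh_4(u)$, $b_2(u,v)=0$, $c_1(u,v)=\bigl(\frac{v^2}{2}-1\bigr)h_1(u)-vh_2(u)-\frac{v^2}{2}h_4(u)$, $c_2(u,v)=-1$, $e_1(u,v)=\frac{v^2}{2}h_3(u)+vh_5(u)+\bigl(\frac{v^2}{2}-1\bigr)h_6(u)$, $e_2(u,v)=0$, $f_1(u,v)=vh_3(u)+h_5(u)+vh_6(u)$, $f_2(u,v)=0$,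 $g_1(u,v)=-\frac{v^2}{2}h_1(u)+vh_2(u)+\bigl(1+\frac{v^2}{2}\bigr)h_4(u)$, $g_2(u,v)=1$.
   Context: $\mathbb{R}^4_1$ is $\mathbb{R}^4$ with the pseudo inner product $\langle \boldsymbol{x},\boldsymbol{y}\rangle=-x_1y_1+x_2y_2+x_3y_3+x_4y_4$. The pseudo vector product $\boldsymbol{x}\wedge\boldsymbol{y}\wedge\boldsymbol{z}$ of three vectors of $\mathbb{R}^4_1$ is the unique vector with $\langle \boldsymbol{w},\boldsymbol{x}\wedge\boldsymbol{y}\wedge\boldsymbol{z}\rangle=\det(\boldsymbol{w},\boldsymbol{x},\boldsymbol{y},\boldsymbol{z})$ for all $\boldsymbol{w}\in\mathbb{R}^4_1$. $H^3=\{\boldsymbol{x}\in\mathbb{R}^4_1: \langle\boldsymbol{x},\boldsymbol{x}\rangle=-1,\ x_1>0\}$, $S^3_1=\{\boldsymbol{x}\in\mathbb{R}^4_1:\langle\boldsymbol{x},\boldsymbol{x}\rangle=1\}$, $\Delta_5=\{(\boldsymbol{\nu}_1,\boldsymbol{\nu}_2)\in S^3_1\times S^3_1:\langle\boldsymbol{\nu}_1,\boldsymbol{\nu}_2\rangle=0\}$. $I$ is an interval in $\mathbb{R}$; subscripts $u,v$ on maps denote partial derivatives; all maps are $C^\infty$. Setting for horocyclic surfaces: $\boldsymbol{a}_0:I\to H^3$ and $\boldsymbol{a}_1,\boldsymbol{a}_2:I\to S^3_1$ are smooth with $\langle\boldsymbol{a}_i(u),\boldsymbol{a}_j(u)\rangle=0$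 for $i\neq j$ in $\{0,1,2\}$ and all $u\in I$; $\boldsymbol{a}_3=\boldsymbol{a}_0\wedge\boldsymbol{a}_1\wedge\boldsymbol{a}_2$; and $h_1,\dots,h_6:I\to\mathbb{R}$ are the smooth functions given by $\boldsymbol{a}_0'=h_1\boldsymbol{a}_1+h_2\boldsymbol{a}_2+h_3\boldsymbol{a}_3$, $\boldsymbol{a}_1'=h_1\boldsymbol{a}_0+h_4\boldsymbol{a}_2+h_5\boldsymbol{a}_3$, $\boldsymbol{a}_2'=h_2\boldsymbol{a}_0-h_4\boldsymbol{a}_1+h_6\boldsymbol{a}_3$, $\boldsymbol{a}_3'=h_3\boldsymbol{a}_0-h_5\boldsymbol{a}_1-h_6\boldsymbol{a}_2$. Hyperbolic generalized framed surface (on a domain $U$, here $U=I\times\mathbb{R}$): a smooth map $(\boldsymbol{x},\boldsymbol{\nu}_1,\boldsymbol{\nu}_2):U\to H^3\times\Delta_5$ with $\langle\boldsymbol{x},\boldsymbol{\nu}_1\rangle=\langle\boldsymbol{x},\boldsymbol{\nu}_2\rangle=0$ on $U$ for which there are smooth functions $\alpha,\beta:U\to\mathbb{R}$ with $\boldsymbol{x}\wedge\boldsymbol{x}_u\wedge\boldsymbol{x}_v=\alpha\boldsymbol{\nu}_1+\beta\boldsymbol{\nu}_2$ on $U$. With $\boldsymbol{\nu}_3=\boldsymbol{x}\wedge\boldsymbol{\nu}_1\wedge\boldsymbol{\nu}_2$, its basic invariants are the smooth functions given by $\boldsymbol{x}_u=a_1\boldsymbol{\nu}_1+b_1\boldsymbol{\nu}_2+c_1\boldsymbol{\nu}_3$,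 $\boldsymbol{\nu}_{1u}=a_1\boldsymbol{x}+e_1\boldsymbol{\nu}_2+f_1\boldsymbol{\nu}_3$, $\boldsymbol{\nu}_{2u}=b_1\boldsymbol{x}-e_1\boldsymbol{\nu}_1+g_1\boldsymbol{\nu}_3$, $\boldsymbol{\nu}_{3u}=c_1\boldsymbol{x}-f_1\boldsymbol{\nu}_1-g_1\boldsymbol{\nu}_2$, and the same formulas with $u$ replaced by $v$ and index $1$ by $2$. *)

theory Defs
  imports "HOL-Analysis.Analysis"
begin

text \<open>
  \<open>C_k_on k S f\<close>: \<open>f\<close> is of class \<open>C^k\<close> on \<open>S\<close>.  Derivatives are taken within \<open>S\<close>, so that
  boundary points of \<open>S\<close> (for instance an end point of an interval) are covered by one-sided
  derivatives; on open \<open>S\<close> this is the usual notion.  It is meant for sets on which derivatives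
  within \<open>S\<close> are unique, such as convex sets with nonempty interior.  As the domain is
  finite-dimensional, continuity of the derivative amounts to continuity of all directional
  derivatives \<open>\<lambda>x. f' x h\<close>.
\<close>

primrec C_k_on ::
  "nat \<Rightarrow> 'a::euclidean_space set \<Rightarrow> ('a \<Rightarrow> 'b::real_normed_vector) \<Rightarrow> bool" where
  "C_k_on 0 S f \<longleftrightarrow> continuous_on S f"
| "C_k_on (Suc k) S f \<longleftrightarrow>
     (\<exists>f'. (\<forall>x\<in>S. (f has_derivative f' x) (at x within S)) \<and>
           (\<forall>h. C_k_on k S (\<lambda>x. f' x h)))"

definition smooth_on :: "'a::euclidean_space set \<Rightarrow> ('a \<Rightarrow> 'b::real_normed_vector) \<Rightarrow> bool" where
  "smooth_on S f \<longleftrightarrow> (\<forall>k. C_k_on k S f)"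

definition partial_u ::
  "(real \<times> real) set \<Rightarrow> (real \<times> real \<Rightarrow> 'b::real_normed_vector) \<Rightarrow> real \<times> real \<Rightarrow> 'b" where
  "partial_u U f = (\<lambda>(u, v). vector_derivative (\<lambda>s. f (s, v)) (at u within {s. (s, v) \<in> U}))"

definition partial_v ::
  "(real \<times> real) set \<Rightarrow> (real \<times> real \<Rightarrow> 'b::real_normed_vector) \<Rightarrow> real \<times> real \<Rightarrow> 'b" where
  "partial_v U f = (\<lambda>(u, v). vector_derivative (\<lambda>t. f (u, t)) (at v within {t. (u, t) \<in> U}))"

definition lorentz :: "real^4 \<Rightarrow> real^4 \<Rightarrow> real" where
  "lorentz x y = - (x $ 1 * y $ 1) + x $ 2 * y $ 2 + x $ 3 * y $ 3 + x $ 4 * y $ 4"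

text \<open>\<open>vector [w, x, y, z]\<close> is the matrix with rows \<open>w, x, y, z\<close>.\<close>

definition wedge3 :: "real^4 \<Rightarrow> real^4 \<Rightarrow> real^4 \<Rightarrow> real^4" where
  "wedge3 x y z = (THE p. \<forall>w. lorentz w p = det (vector [w, x, y, z] :: real^4^4))"

lemma vector_4_eq_if:
  "(vector [w, x, y, z] :: real^4^4) =
     (\<chi> i. if i = 1 then w else if i = 2 then x else if i = 3 then y else z)"
  by (simp add: vec_eq_iff vector_def forall_4)

lemma linear_det_first_row:
  "linear (\<lambda>w. det (vector [w, x, y, z] :: real^4^4))"
proof (rule linearI)
  fix a b :: "real^4" and c :: real
  show "det (vector [a + b, x, y, z] :: real^4^4) =
        det (vector [a, x, y, z] :: real^4^4) + det (vector [b, x, y, z] :: real^4^4)"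
    unfolding vector_4_eq_if
    using det_row_add [of 1 "\<lambda>_. a" "\<lambda>_. b"
        "\<lambda>i. if i = 2 then x else if i = 3 then y else z"] by simp
  show "det (vector [c *\<^sub>R a, x, y, z] :: real^4^4) =
        c *\<^sub>R det (vector [a, x, y, z] :: real^4^4)"
    unfolding vector_4_eq_if
    using det_row_mul [of 1 c "\<lambda>_. a"
        "\<lambda>i. if i = 2 then x else if i = 3 then y else z"]
    unfolding scalar_mult_eq_scaleR by simp
qed

lemma wedge3_ex1:
  "\<exists>!p. \<forall>w. lorentz w p = det (vector [w, x, y, z] :: real^4^4)"
proof -
  define f where "f = (\<lambda>w. det (vector [w, x, y, z] :: real^4^4))"
  have lin: "linear f" unfolding f_def by (rule linear_det_first_row)
  have expand: "f w = w $ 1 * f (axis 1 1) + w $ 2 * f (axis 2 1) + w $ 3 * f (axis 3 1)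
      + w $ 4 * f (axis 4 1)" for w
  proof -
    have "f w = f (\<Sum>i\<in>UNIV. w $ i *\<^sub>R axis i 1)"
      using basis_expansion [of w] by (simp add: scalar_mult_eq_scaleR)
    also have "\<dots> = (\<Sum>i\<in>UNIV. w $ i *\<^sub>R f (axis i 1))"
      by (simp add: linear_sum [OF lin] linear_cmul [OF lin])
    finally show ?thesis by (simp add: sum_4)
  qed
  define p :: "real^4" where
    "p = (\<chi> i. if i = 1 then - f (axis 1 1) else f (axis i 1))"
  have ex: "\<forall>w. lorentz w p = f w"
  proof
    fix w
    show "lorentz w p = f w"
      by (subst expand) (simp add: lorentz_def p_def)
  qed
  have uniq: "q = p" if q: "\<forall>w. lorentz w q = f w" for q
  proof -
    have eq: "lorentz (axis i 1) q = lorentz (axis i 1) p" for i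
      using q ex by simp
    show ?thesis
      using eq [of 1] eq [of 2] eq [of 3] eq [of 4]
      by (simp add: vec_eq_iff forall_4 lorentz_def axis_def)
  qed
  show ?thesis
    using ex uniq unfolding f_def by blast
qed

lemma lorentz_wedge3: "lorentz w (wedge3 x y z) = det (vector [w, x, y, z] :: real^4^4)"
  using theI' [OF wedge3_ex1 [of x y z]] unfolding wedge3_def by blast

definition H3 :: "(real^4) set" where
  "H3 = {x. lorentz x x = - 1 \<and> x $ 1 > 0}"

definition S31 :: "(real^4) set" where
  "S31 = {x. lorentz x x = 1}"

definition Delta5 :: "((real^4) \<times> (real^4)) set" where
  "Delta5 = {(n1, n2). n1 \<in> S31 \<and> n2 \<in> S31 \<and> lorentz n1 n2 = 0}"

definition gfs_coefficients ::
  "(real \<times> real) set \<Rightarrow>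
   (real \<times> real \<Rightarrow> real^4) \<Rightarrow> (real \<times> real \<Rightarrow> real^4) \<Rightarrow> (real \<times> real \<Rightarrow> real^4) \<Rightarrow>
   (real \<times> real \<Rightarrow> real) \<Rightarrow> (real \<times> real \<Rightarrow> real) \<Rightarrow> bool" where
  "gfs_coefficients U x \<nu>\<^sub>1 \<nu>\<^sub>2 \<alpha> \<beta> \<longleftrightarrow>
     smooth_on U \<alpha> \<and> smooth_on U \<beta> \<and>
     (\<forall>p\<in>U. wedge3 (x p) (partial_u U x p) (partial_v U x p) = \<alpha> p *\<^sub>R \<nu>\<^sub>1 p + \<beta> p *\<^sub>R \<nu>\<^sub>2 p)"

definition hyperbolic_gfs ::
  "(real \<times> real) set \<Rightarrow>
   (real \<times> real \<Rightarrow> real^4) \<Rightarrow> (real \<times> real \<Rightarrow> real^4) \<Rightarrow> (real \<times> real \<Rightarrow> real^4) \<Rightarrow> bool" where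
  "hyperbolic_gfs U x \<nu>\<^sub>1 \<nu>\<^sub>2 \<longleftrightarrow>
     smooth_on U x \<and> smooth_on U \<nu>\<^sub>1 \<and> smooth_on U \<nu>\<^sub>2 \<and>
     (\<forall>p\<in>U. x p \<in> H3 \<and> (\<nu>\<^sub>1 p, \<nu>\<^sub>2 p) \<in> Delta5 \<and>
            lorentz (x p) (\<nu>\<^sub>1 p) = 0 \<and> lorentz (x p) (\<nu>\<^sub>2 p) = 0) \<and>
     (\<exists>\<alpha> \<beta>. gfs_coefficients U x \<nu>\<^sub>1 \<nu>\<^sub>2 \<alpha> \<beta>)"

definition nu3 ::
  "(real \<times> real \<Rightarrow> real^4) \<Rightarrow> (real \<times> real \<Rightarrow> real^4) \<Rightarrow> (real \<times> real \<Rightarrow> real^4) \<Rightarrow>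
   real \<times> real \<Rightarrow> real^4" where
  "nu3 x \<nu>\<^sub>1 \<nu>\<^sub>2 = (\<lambda>p. wedge3 (x p) (\<nu>\<^sub>1 p) (\<nu>\<^sub>2 p))"

text \<open>
  The basic invariants come in two groups given by the same formulas: \<open>a\<^sub>1, \<dots>, g\<^sub>1\<close> for
  \<open>D = partial_u U\<close> and \<open>a\<^sub>2, \<dots>, g\<^sub>2\<close> for \<open>D = partial_v U\<close>.
\<close>

definition basic_invariants ::
  "(real \<times> real) set \<Rightarrow> ((real \<times> real \<Rightarrow> real^4) \<Rightarrow> real \<times> real \<Rightarrow> real^4) \<Rightarrow>
   (real \<times> real \<Rightarrow> real^4) \<Rightarrow> (real \<times> real \<Rightarrow> real^4) \<Rightarrow> (real \<times> real \<Rightarrow> real^4) \<Rightarrow>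
   (real \<times> real \<Rightarrow> real) \<Rightarrow> (real \<times> real \<Rightarrow> real) \<Rightarrow> (real \<times> real \<Rightarrow> real) \<Rightarrow>
   (real \<times> real \<Rightarrow> real) \<Rightarrow> (real \<times> real \<Rightarrow> real) \<Rightarrow> (real \<times> real \<Rightarrow> real) \<Rightarrow> bool" where
  "basic_invariants U D x \<nu>\<^sub>1 \<nu>\<^sub>2 a b c e f g \<longleftrightarrow>
     smooth_on U a \<and> smooth_on U b \<and> smooth_on U c \<and>
     smooth_on U e \<and> smooth_on U f \<and> smooth_on U g \<and>
     (let \<nu>\<^sub>3 = nu3 x \<nu>\<^sub>1 \<nu>\<^sub>2 in \<forall>p\<in>U.
        D x p = a p *\<^sub>R \<nu>\<^sub>1 p + b p *\<^sub>R \<nu>\<^sub>2 p + c p *\<^sub>R \<nu>\<^sub>3 p \<and>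
        D \<nu>\<^sub>1 p = a p *\<^sub>R x p + e p *\<^sub>R \<nu>\<^sub>2 p + f p *\<^sub>R \<nu>\<^sub>3 p \<and>
        D \<nu>\<^sub>2 p = b p *\<^sub>R x p - e p *\<^sub>R \<nu>\<^sub>1 p + g p *\<^sub>R \<nu>\<^sub>3 p \<and>
        D \<nu>\<^sub>3 p = c p *\<^sub>R x p - f p *\<^sub>R \<nu>\<^sub>1 p - g p *\<^sub>R \<nu>\<^sub>2 p)"

end

theory Submission
  imports Defs
begin

text \<open>
  The statement is a computation in the moving frame \<open>a\<^sub>0, a\<^sub>1, a\<^sub>2, a\<^sub>3\<close>. In it, \<open>x\<close> and
  \<open>\<nu>\<^sub>2\<close> lie in the Lorentzian 3-space spanned by \<open>a\<^sub>0, a\<^sub>1, a\<^sub>2\<close>, and \<open>\<nu>\<^sub>1 = a\<^sub>3\<close> is its unit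
  normal. For fixed \<open>u\<close>, the curve \<open>v \<mapsto> x(u, v)\<close> is the orbit of \<open>a\<^sub>0\<close> under the one-parameter
  group of Lorentz transformations that fixes \<open>a\<^sub>3\<close> and the light-like vector \<open>a\<^sub>0 + a\<^sub>2\<close>. This
  group takes \<open>a\<^sub>0, a\<^sub>1, a\<^sub>2\<close> to \<open>x, a\<^sub>1 + v(a\<^sub>0 + a\<^sub>2), \<nu>\<^sub>2\<close>, so \<open>x, \<nu>\<^sub>1, \<nu>\<^sub>2\<close> are pseudo-orthonormal
  and \<open>\<nu>\<^sub>3 = - (a\<^sub>1 + v(a\<^sub>0 + a\<^sub>2)) = - x\<^sub>v\<close> (\<open>horocycle_frame\<close>).

  Vector products are evaluated with the expansion of \<open>x \<and> y \<and> (p \<and> q \<and> r)\<close> as a combination of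
  \<open>p, q, r\<close> with scalar products as coefficients (\<open>wedge3_wedge3\<close>). All the products that occur
  have this form once \<open>a\<^sub>3\<close> or \<open>\<nu>\<^sub>3\<close> is read as a product, so no coordinates of the frame are needed.

  The basic invariants are then read off by differentiating \<open>x, \<nu>\<^sub>1, \<nu>\<^sub>2, \<nu>\<^sub>3\<close> with the structure
  equations and comparing coefficients of \<open>a\<^sub>0, a\<^sub>1, a\<^sub>2, a\<^sub>3\<close>. Since \<open>x\<^sub>v = - \<nu>\<^sub>3\<close>, the normal
  coefficients \<open>\<alpha>\<close> and \<open>\<beta>\<close> are up to sign the components of \<open>x\<^sub>u\<close> along \<open>\<nu>\<^sub>2\<close> and \<open>\<nu>\<^sub>1\<close>
  (\<open>wedge3_tangents\<close>), that is, \<open>\<alpha> = - b\<^sub>1\<close> and \<open>\<beta> = a\<^sub>1\<close>.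

  Smoothness follows from closure of \<open>smooth_on\<close> under the operations involved. For \<open>a\<^sub>3\<close> it comes
  from its structure equation, whose right-hand side is smooth
  (\<open>smooth_on_if_smooth_vector_derivative\<close>).
\<close>

section \<open>The vector product of Minkowski 4-space\<close>

lemma det_4:
  fixes A :: "'a::comm_ring_1^4^4"
  shows "det A =
      A$1$1 * (A$2$2 * (A$3$3 * A$4$4 - A$3$4 * A$4$3) - A$2$3 * (A$3$2 * A$4$4 - A$3$4 * A$4$2)
               + A$2$4 * (A$3$2 * A$4$3 - A$3$3 * A$4$2))
    - A$1$2 * (A$2$1 * (A$3$3 * A$4$4 - A$3$4 * A$4$3) - A$2$3 * (A$3$1 * A$4$4 - A$3$4 * A$4$1)
               + A$2$4 * (A$3$1 * A$4$3 - A$3$3 * A$4$1))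
    + A$1$3 * (A$2$1 * (A$3$2 * A$4$4 - A$3$4 * A$4$2) - A$2$2 * (A$3$1 * A$4$4 - A$3$4 * A$4$1)
               + A$2$4 * (A$3$1 * A$4$2 - A$3$2 * A$4$1))
    - A$1$4 * (A$2$1 * (A$3$2 * A$4$3 - A$3$3 * A$4$2) - A$2$2 * (A$3$1 * A$4$3 - A$3$3 * A$4$1)
               + A$2$3 * (A$3$1 * A$4$2 - A$3$2 * A$4$1))"
proof -
  have f1: "finite {2::4, 3, 4}" "1 \<notin> {2::4, 3, 4}" by auto
  have f2: "finite {3::4, 4}" "2 \<notin> {3::4, 4}" by auto
  have f3: "finite {4::4}" "3 \<notin> {4::4}" by auto
  have neq: "(1::4) \<noteq> 2" "(1::4) \<noteq> 3" "(1::4) \<noteq> 4" "(2::4) \<noteq> 3" "(2::4) \<noteq> 4" "(3::4) \<noteq> 4"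
    by simp_all
  show ?thesis
    unfolding det_def UNIV_4
    unfolding sum_over_permutations_insert[OF f1]
    unfolding sum_over_permutations_insert[OF f2]
    unfolding sum_over_permutations_insert[OF f3]
    unfolding permutes_sing
    using neq
    by (simp add: sign_swap_id permutation_swap_id sign_compose permutation_compose sign_id swap_id_eq)
       (simp add: algebra_simps transpose_def)
qed

lemma wedge3_nth:
  "wedge3 x y z $ 1 =
     - (x$2 * (y$3 * z$4 - y$4 * z$3) - x$3 * (y$2 * z$4 - y$4 * z$2) + x$4 * (y$2 * z$3 - y$3 * z$2))"
  "wedge3 x y z $ 2 =
     - (x$1 * (y$3 * z$4 - y$4 * z$3) - x$3 * (y$1 * z$4 - y$4 * z$1) + x$4 * (y$1 * z$3 - y$3 * z$1))"
  "wedge3 x y z $ 3 =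
     x$1 * (y$2 * z$4 - y$4 * z$2) - x$2 * (y$1 * z$4 - y$4 * z$1) + x$4 * (y$1 * z$2 - y$2 * z$1)"
  "wedge3 x y z $ 4 =
     - (x$1 * (y$2 * z$3 - y$3 * z$2) - x$2 * (y$1 * z$3 - y$3 * z$1) + x$3 * (y$1 * z$2 - y$2 * z$1))"
  using lorentz_wedge3[of "axis 1 1" x y z] lorentz_wedge3[of "axis 2 1" x y z]
    lorentz_wedge3[of "axis 3 1" x y z] lorentz_wedge3[of "axis 4 1" x y z]
  by (simp_all add: lorentz_def det_4 vector_4_eq_if axis_def)

lemma wedge3_swap: "wedge3 x z y = - wedge3 x y z"
  by (simp add: vec_eq_iff forall_4 wedge3_nth algebra_simps)

lemma wedge3_same: "wedge3 x y y = 0"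
  by (simp add: vec_eq_iff forall_4 wedge3_nth algebra_simps)

lemma wedge3_combination:
  "wedge3 x (r *\<^sub>R p + s *\<^sub>R q + t *\<^sub>R y) z =
     r *\<^sub>R wedge3 x p z + s *\<^sub>R wedge3 x q z + t *\<^sub>R wedge3 x y z"
  by (simp add: vec_eq_iff forall_4 wedge3_nth algebra_simps)

lemma wedge3_minus: "wedge3 x y (- z) = - wedge3 x y z"
  by (simp add: vec_eq_iff forall_4 wedge3_nth algebra_simps)

lemma lorentz_wedge3_swap: "lorentz w (wedge3 x y z) = - lorentz z (wedge3 x y w)"
  by (simp add: lorentz_def wedge3_nth algebra_simps)

lemma lorentz_wedge3_self:
  "lorentz x (wedge3 x y z) = 0" "lorentz y (wedge3 x y z) = 0" "lorentz z (wedge3 x y z) = 0"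
  "lorentz (wedge3 x y z) x = 0" "lorentz (wedge3 x y z) y = 0" "lorentz (wedge3 x y z) z = 0"
  by (simp_all add: lorentz_def wedge3_nth algebra_simps)

lemma lorentz_commute: "lorentz x y = lorentz y x"
  by (simp add: lorentz_def)

lemma lorentz_bilinear:
  "lorentz (x + y) z = lorentz x z + lorentz y z"
  "lorentz x (y + z) = lorentz x y + lorentz x z"
  "lorentz (x - y) z = lorentz x z - lorentz y z"
  "lorentz x (y - z) = lorentz x y - lorentz x z"
  "lorentz (- x) z = - lorentz x z"
  "lorentz x (- z) = - lorentz x z"
  "lorentz (r *\<^sub>R x) z = r * lorentz x z"
  "lorentz x (r *\<^sub>R z) = r * lorentz x z"
  by (simp_all add: lorentz_def algebra_simps)

text \<open>
  This is the analogue of the expansion of the double cross product in Euclidean 3-space.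
\<close>

lemma wedge3_wedge3:
  "wedge3 x y (wedge3 p q r) =
     (lorentz x q * lorentz y r - lorentz x r * lorentz y q) *\<^sub>R p +
     (lorentz x r * lorentz y p - lorentz x p * lorentz y r) *\<^sub>R q +
     (lorentz x p * lorentz y q - lorentz x q * lorentz y p) *\<^sub>R r"
  by (simp add: vec_eq_iff forall_4 wedge3_nth lorentz_def algebra_simps)

text \<open>
  Two vectors in opposite sheets of the hyperboloid have a positive product, by the
  Cauchy-Schwarz inequality for their spatial parts. A negative product with a point of \<open>H3\<close>
  therefore decides the sheet.
\<close>

lemma H3_if_lorentz_negative:
  assumes "lorentz x x = - 1" "y \<in> H3" "lorentz x y < 0"
  shows "x \<in> H3"
proof -
  have y: "lorentz y y = - 1" "y$1 > 0" using assms by (auto simp: H3_def)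
  have "x$1 > 0"
  proof (rule ccontr)
    assume "\<not> x$1 > 0"
    define s where "s = x$2 * y$2 + x$3 * y$3 + x$4 * y$4"
    define X where "X = (x$2)\<^sup>2 + (x$3)\<^sup>2 + (x$4)\<^sup>2"
    define Y where "Y = (y$2)\<^sup>2 + (y$3)\<^sup>2 + (y$4)\<^sup>2"
    have X: "(x$1)\<^sup>2 = 1 + X" "X \<ge> 0" and Y: "(y$1)\<^sup>2 = 1 + Y" "Y \<ge> 0"
      using assms y by (auto simp: X_def Y_def lorentz_def power2_eq_square)
    have "s < x$1 * y$1" using assms by (simp add: s_def lorentz_def)
    moreover have "x$1 * y$1 \<le> 0"
      using \<open>\<not> x$1 > 0\<close> y by (simp add: mult_nonpos_nonneg)
    ultimately have "\<bar>x$1 * y$1\<bar> < \<bar>s\<bar>" by linarith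
    then have "(x$1 * y$1)\<^sup>2 < s\<^sup>2"
      by (simp add: abs_le_square_iff flip: linorder_not_le)
    \<comment> \<open>The Cauchy-Schwarz defect is a sum of squares (Lagrange's identity).\<close>
    moreover have "X * Y - s\<^sup>2 = (x$2 * y$3 - x$3 * y$2)\<^sup>2 + (x$2 * y$4 - x$4 * y$2)\<^sup>2
        + (x$3 * y$4 - x$4 * y$3)\<^sup>2"
      by (simp add: X_def Y_def s_def power2_eq_square algebra_simps)
    then have "s\<^sup>2 \<le> X * Y"
      by (smt (verit) zero_le_power2)
    moreover have "(x$1 * y$1)\<^sup>2 = 1 + X + Y + X * Y"
      by (simp add: power_mult_distrib X Y algebra_simps)
    ultimately show False using X Y by linarith
  qed
  then show ?thesis using assms by (simp add: H3_def)
qed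

section \<open>Smooth maps\<close>

lemma C_k_on_Suc_imp: "C_k_on (Suc k) S f \<Longrightarrow> C_k_on k S f"
proof (induction k arbitrary: f)
  case 0
  then show ?case
    by (auto simp: continuous_on_eq_continuous_within intro: has_derivative_continuous)
next
  case (Suc k)
  from Suc.prems obtain f' where f': "\<forall>x\<in>S. (f has_derivative f' x) (at x within S)"
    and "\<forall>h. C_k_on (Suc k) S (\<lambda>x. f' x h)" unfolding C_k_on.simps(2)[of "Suc k"] by blast
  then have "\<forall>h. C_k_on k S (\<lambda>x. f' x h)" using Suc.IH by blast
  with f' show ?case unfolding C_k_on.simps by blast
qed

lemma C_k_on_const: "C_k_on k S (\<lambda>x. c)"
proof (induction k arbitrary: c)
  case (Suc k)
  then show ?case
    unfolding C_k_on.simps by (intro exI[of _ "\<lambda>_ _. 0"] conjI ballI allI has_derivative_const)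
qed simp

lemma C_k_on_bounded_linear:
  assumes "bounded_linear L" "C_k_on k S f"
  shows "C_k_on k S (\<lambda>x. L (f x))"
  using assms(2)
proof (induction k arbitrary: f)
  case 0
  then show ?case using bounded_linear.continuous_on[OF assms(1)] by simp
next
  case (Suc k)
  then obtain f' where "\<forall>x\<in>S. (f has_derivative f' x) (at x within S)"
    and "\<forall>h. C_k_on k S (\<lambda>x. f' x h)" unfolding C_k_on.simps by blast
  then show ?case
    unfolding C_k_on.simps using Suc.IH bounded_linear.has_derivative[OF assms(1)]
    by (intro exI[of _ "\<lambda>x h. L (f' x h)"]) blast
qed

lemma C_k_on_add:
  assumes "C_k_on k S f" "C_k_on k S g"
  shows "C_k_on k S (\<lambda>x. f x + g x)"
  using assms
proof (induction k arbitrary: f g)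
  case 0
  then show ?case by (simp add: continuous_on_add)
next
  case (Suc k)
  then obtain f' g' where "\<forall>x\<in>S. (f has_derivative f' x) (at x within S)"
    "\<forall>h. C_k_on k S (\<lambda>x. f' x h)" "\<forall>x\<in>S. (g has_derivative g' x) (at x within S)"
    "\<forall>h. C_k_on k S (\<lambda>x. g' x h)" unfolding C_k_on.simps by blast
  then show ?case
    unfolding C_k_on.simps using Suc.IH has_derivative_add
    by (intro exI[of _ "\<lambda>x h. f' x h + g' x h"]) blast
qed

text \<open>
  The Leibniz rule differentiates only one factor at a time, so the induction needs the other factor,
  of class \<open>C\<^sup>k\<^sup>+\<^sup>1\<close>, to be of class \<open>C\<^sup>k\<close> as well; this is what \<open>C_k_on_Suc_imp\<close> is for.
\<close>

lemma C_k_on_bounded_bilinear: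
  assumes "bounded_bilinear B" "C_k_on k S f" "C_k_on k S g"
  shows "C_k_on k S (\<lambda>x. B (f x) (g x))"
  using assms(2,3)
proof (induction k arbitrary: f g)
  case 0
  then show ?case using bounded_bilinear.continuous_on[OF assms(1)] by simp
next
  case (Suc k)
  have fg: "C_k_on k S f" "C_k_on k S g" using Suc.prems by (blast intro: C_k_on_Suc_imp)+
  from Suc.prems obtain f' g' where f': "\<forall>x\<in>S. (f has_derivative f' x) (at x within S)"
      "\<forall>h. C_k_on k S (\<lambda>x. f' x h)"
    and g': "\<forall>x\<in>S. (g has_derivative g' x) (at x within S)"
      "\<forall>h. C_k_on k S (\<lambda>x. g' x h)" unfolding C_k_on.simps by blast
  have "\<forall>x\<in>S. ((\<lambda>x. B (f x) (g x)) has_derivative (\<lambda>h. B (f x) (g' x h) + B (f' x h) (g x)))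
      (at x within S)"
    using f'(1) g'(1) by (intro ballI bounded_bilinear.FDERIV[OF assms(1)]) auto
  moreover have "\<forall>h. C_k_on k S (\<lambda>x. B (f x) (g' x h) + B (f' x h) (g x))"
    using f'(2) g'(2) fg by (intro allI C_k_on_add Suc.IH) auto
  ultimately show ?case
    unfolding C_k_on.simps
    by (intro exI[of _ "\<lambda>x h. B (f x) (g' x h) + B (f' x h) (g x)"] conjI)
qed

lemma C_k_on_fst:
  assumes "C_k_on k S f"
  shows "C_k_on k (S \<times> T) (\<lambda>p. f (fst p))"
  using assms
proof (induction k arbitrary: f)
  case 0
  then show ?case by (auto intro!: continuous_on_compose2[of S f] continuous_intros)
next
  case (Suc k)
  then obtain f' where f': "\<forall>x\<in>S. (f has_derivative f' x) (at x within S)"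
    and Ck: "\<forall>h. C_k_on k S (\<lambda>x. f' x h)" unfolding C_k_on.simps by blast
  have "((\<lambda>p. f (fst p)) has_derivative (\<lambda>h. f' (fst p) (fst h))) (at p within S \<times> T)"
    if "p \<in> S \<times> T" for p
  proof -
    have 1: "(fst has_derivative fst) (at p within S \<times> T)"
      by (intro derivative_intros)
    have 2: "(f has_derivative f' (fst p)) (at (fst p) within fst ` (S \<times> T))"
      using f' that by (auto intro: has_derivative_subset)
    show ?thesis using has_derivative_in_compose[OF 1 2] .
  qed
  moreover have "\<forall>h. C_k_on k (S \<times> T) (\<lambda>p. f' (fst p) (fst h))"
    using Ck Suc.IH by blast
  ultimately show ?case
    unfolding C_k_on.simps by (intro exI[of _ "\<lambda>p h. f' (fst p) (fst h)"]) blast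
qed

lemma smooth_on_const: "smooth_on S (\<lambda>x. c)"
  by (simp add: smooth_on_def C_k_on_const)

lemma smooth_on_bounded_linear:
  assumes "bounded_linear L" shows "smooth_on S L"
  unfolding smooth_on_def
proof
  fix k show "C_k_on k S L"
  proof (cases k)
    case 0
    then show ?thesis using assms by (simp add: linear_continuous_on)
  next
    case (Suc m)
    have "\<forall>x\<in>S. (L has_derivative L) (at x within S)"
      using bounded_linear_imp_has_derivative[OF assms] by blast
    moreover have "\<forall>h. C_k_on m S (\<lambda>x. L h)"
      by (simp add: C_k_on_const)
    ultimately show ?thesis
      unfolding Suc C_k_on.simps by (intro exI[of _ "\<lambda>_. L"] conjI)
  qed
qed

lemma smooth_on_compose_bounded_linear:
  "bounded_linear L \<Longrightarrow> smooth_on S f \<Longrightarrow> smooth_on S (\<lambda>x. L (f x))"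
  unfolding smooth_on_def by (rule allI, rule C_k_on_bounded_linear, assumption, erule spec)

lemma smooth_on_fst: "smooth_on S f \<Longrightarrow> smooth_on (S \<times> T) (\<lambda>p. f (fst p))"
  unfolding smooth_on_def by (intro allI C_k_on_fst) auto

lemma smooth_on_snd: "smooth_on S snd"
  by (rule smooth_on_bounded_linear) (rule bounded_linear_snd)

lemma smooth_on_add: "smooth_on S f \<Longrightarrow> smooth_on S g \<Longrightarrow> smooth_on S (\<lambda>x. f x + g x)"
  unfolding smooth_on_def by (intro allI C_k_on_add) auto

lemma smooth_on_minus: "smooth_on S f \<Longrightarrow> smooth_on S (\<lambda>x. - f x)"
  by (rule smooth_on_compose_bounded_linear[OF bounded_linear_minus[OF bounded_linear_ident]])

lemma smooth_on_diff: "smooth_on S f \<Longrightarrow> smooth_on S g \<Longrightarrow> smooth_on S (\<lambda>x. f x - g x)"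
  using smooth_on_add[of S f "\<lambda>x. - g x"] by (simp add: smooth_on_minus)

lemma smooth_on_scaleR: "smooth_on S f \<Longrightarrow> smooth_on S g \<Longrightarrow> smooth_on S (\<lambda>x. f x *\<^sub>R g x)"
  unfolding smooth_on_def by (intro allI C_k_on_bounded_bilinear[OF bounded_bilinear_scaleR]) auto

lemma smooth_on_mult:
  fixes f g :: "'a::euclidean_space \<Rightarrow> real"
  shows "smooth_on S f \<Longrightarrow> smooth_on S g \<Longrightarrow> smooth_on S (\<lambda>x. f x * g x)"
  using smooth_on_scaleR[of S f g] by simp

lemma smooth_on_half_square:
  fixes f :: "'a::euclidean_space \<Rightarrow> real"
  assumes "smooth_on S f" shows "smooth_on S (\<lambda>x. (f x)\<^sup>2 / 2)"
  using smooth_on_mult[OF smooth_on_const[of S "1/2"] smooth_on_mult[OF assms assms]]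
  by (simp add: power2_eq_square)

lemmas smooth_intros = smooth_on_const smooth_on_fst smooth_on_snd smooth_on_add smooth_on_minus
  smooth_on_diff smooth_on_scaleR smooth_on_mult smooth_on_half_square

text \<open>
  The derivative of \<open>f\<close> at \<open>u\<close> is \<open>h \<mapsto> h f'(u)\<close>, which is smooth in \<open>u\<close> for each direction
  \<open>h\<close>.
\<close>

lemma smooth_on_if_smooth_vector_derivative:
  assumes "\<And>u. u \<in> S \<Longrightarrow> (f has_vector_derivative f' u) (at u within S)" and "smooth_on S f'"
  shows "smooth_on S f"
  unfolding smooth_on_def
proof
  fix k show "C_k_on k S f"
  proof (cases k)
    case 0
    then show ?thesis
      using assms(1) by (auto simp: continuous_on_eq_continuous_within
          intro: has_vector_derivative_continuous)
  next
    case (Suc m)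
    have "smooth_on S (\<lambda>x. h *\<^sub>R f' x)" for h
      by (intro smooth_intros assms)
    then have "\<forall>h. C_k_on m S (\<lambda>x. h *\<^sub>R f' x)"
      by (simp add: smooth_on_def)
    moreover have "\<forall>x\<in>S. (f has_derivative (\<lambda>h. h *\<^sub>R f' x)) (at x within S)"
      using assms(1) by (simp add: has_vector_derivative_def)
    ultimately show ?thesis
      unfolding Suc C_k_on.simps by (intro exI[of _ "\<lambda>u h. h *\<^sub>R f' u"] conjI)
  qed
qed

text \<open>
  The operator \<open>vector_derivative\<close> picks some derivative within the set; it can be evaluated only
  where that derivative is unique, that is, at limit points.
\<close>

lemma interval_at_within_nontrivial:
  fixes I :: "real set"
  assumes "is_interval I" "interior I \<noteq> {}" "u \<in> I"
  shows "at u within I \<noteq> bot"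
proof -
  have "\<not> I \<subseteq> {u}"
    using assms by (metis interior_mono interior_singleton subset_empty)
  then have "\<nexists>a. I = {a}" using assms by auto
  with assms show ?thesis
    using connected_imp_perfect[of I u] by (auto simp: trivial_limit_within is_interval_connected)
qed

lemma partial_u_eqI:
  assumes "is_interval I" "interior I \<noteq> {}" "u \<in> I"
    and "((\<lambda>s. f (s, v)) has_vector_derivative D) (at u within I)"
  shows "partial_u (I \<times> UNIV) f (u, v) = D"
  using assms by (simp add: partial_u_def vector_derivative_within interval_at_within_nontrivial)

lemma partial_v_eqI:
  assumes "u \<in> I" and "((\<lambda>t. f (u, t)) has_vector_derivative D) (at v)"
  shows "partial_v (I \<times> UNIV) f (u, v) = D"
  using assms by (simp add: partial_v_def vector_derivative_at)

section \<open>Pseudo-orthonormal frames and horocycles\<close>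

definition lorentz_frame :: "real^4 \<Rightarrow> real^4 \<Rightarrow> real^4 \<Rightarrow> bool" where
  "lorentz_frame p m n \<longleftrightarrow>
     lorentz p p = - 1 \<and> lorentz m m = 1 \<and> lorentz n n = 1 \<and>
     lorentz p m = 0 \<and> lorentz p n = 0 \<and> lorentz m n = 0"

lemma lorentz_frameD:
  assumes "lorentz_frame p m n"
  shows "lorentz p p = - 1" "lorentz m m = 1" "lorentz n n = 1"
    "lorentz p m = 0" "lorentz p n = 0" "lorentz m n = 0"
    "lorentz m p = 0" "lorentz n p = 0" "lorentz n m = 0"
  using assms by (auto simp: lorentz_frame_def lorentz_commute)

lemma wedge3_frame:
  assumes "lorentz_frame p m n"
  shows "wedge3 p m (wedge3 p m n) = - n" "wedge3 p n (wedge3 p m n) = m"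
  by (simp_all add: wedge3_wedge3 lorentz_frameD[OF assms])

text \<open>
  Swapping the outer \<open>wedge3 p m n\<close> with \<open>n\<close> in the determinant turns the square into
  \<open>- \<langle>n, p \<and> m \<and> (p \<and> m \<and> n)\<rangle> = \<langle>n, n\<rangle>\<close>.
\<close>

lemma lorentz_wedge3_frame:
  assumes "lorentz_frame p m n"
  shows "lorentz (wedge3 p m n) (wedge3 p m n) = 1"
  by (subst lorentz_wedge3_swap) (simp add: wedge3_frame[OF assms] lorentz_bilinear lorentz_frameD[OF assms])

text \<open>
  When \<open>x\<^sub>v = - \<nu>\<^sub>3\<close>, the component of \<open>x\<^sub>u\<close> along \<open>\<nu>\<^sub>3\<close> drops out of \<open>x \<and> x\<^sub>u \<and> x\<^sub>v\<close>, and
  the other two are rotated by a right angle.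
\<close>

lemma wedge3_tangents:
  assumes "lorentz_frame p m n"
  shows "wedge3 p (a *\<^sub>R m + b *\<^sub>R n + c *\<^sub>R wedge3 p m n) (- wedge3 p m n) = - b *\<^sub>R m + a *\<^sub>R n"
  by (simp add: wedge3_minus wedge3_combination wedge3_same wedge3_frame[OF assms])

text \<open>
  A parabolic Lorentz transformation fixing \<open>p + n\<close> moves the frame along the horocycle. The last
  claim serves to place the horocycle in the sheet \<open>H3\<close> that contains \<open>p\<close>.
\<close>

lemma horocycle_frame:
  fixes v :: real
  assumes frame: "lorentz_frame p m n"
  defines "x \<equiv> p + v *\<^sub>R m + (v\<^sup>2 / 2) *\<^sub>R (p + n)"
    and "\<nu> \<equiv> - (v\<^sup>2 / 2) *\<^sub>R p - v *\<^sub>R m + (1 - v\<^sup>2 / 2) *\<^sub>R n"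
  shows "lorentz_frame x (wedge3 p m n) \<nu>"
    and "wedge3 x (wedge3 p m n) \<nu> = - (m + v *\<^sub>R (p + n))"
    and "lorentz x p = - (1 + v\<^sup>2 / 2)"
proof -
  note L = lorentz_frameD[OF frame]
  show "lorentz x p = - (1 + v\<^sup>2 / 2)"
    by (simp add: x_def lorentz_bilinear L)
  show "lorentz_frame x (wedge3 p m n) \<nu>"
    unfolding lorentz_frame_def x_def \<nu>_def
    by (simp add: lorentz_bilinear L lorentz_wedge3_frame[OF frame] lorentz_wedge3_self field_simps power2_eq_square)
  \<comment> \<open>With the normal in the last place, the double product expands in terms of \<open>p, m, n\<close>.\<close>
  have "wedge3 x \<nu> (wedge3 p m n) = v *\<^sub>R p + m + v *\<^sub>R n"
    unfolding wedge3_wedge3 x_def \<nu>_def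
    by (simp add: lorentz_bilinear L vec_eq_iff field_simps power2_eq_square)
  then show "wedge3 x (wedge3 p m n) \<nu> = - (m + v *\<^sub>R (p + n))"
    by (subst wedge3_swap) (simp add: algebra_simps)
qed

section \<open>The horocyclic surface\<close>

theorem proposition5p2:
  fixes I :: "real set"
    and a\<^sub>0 a\<^sub>1 a\<^sub>2 a\<^sub>3 :: "real \<Rightarrow> real^4"
    and h\<^sub>1 h\<^sub>2 h\<^sub>3 h\<^sub>4 h\<^sub>5 h\<^sub>6 :: "real \<Rightarrow> real"
    and x \<nu>\<^sub>1 \<nu>\<^sub>2 :: "real \<times> real \<Rightarrow> real^4"
  assumes I: "is_interval I" "interior I \<noteq> {}"
    and a_smooth: "smooth_on I a\<^sub>0" "smooth_on I a\<^sub>1" "smooth_on I a\<^sub>2"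
    and a0_H3: "\<And>u. u \<in> I \<Longrightarrow> a\<^sub>0 u \<in> H3"
    and a1_S31: "\<And>u. u \<in> I \<Longrightarrow> a\<^sub>1 u \<in> S31"
    and a2_S31: "\<And>u. u \<in> I \<Longrightarrow> a\<^sub>2 u \<in> S31"
    and orth01: "\<And>u. u \<in> I \<Longrightarrow> lorentz (a\<^sub>0 u) (a\<^sub>1 u) = 0"
    and orth02: "\<And>u. u \<in> I \<Longrightarrow> lorentz (a\<^sub>0 u) (a\<^sub>2 u) = 0"
    and orth12: "\<And>u. u \<in> I \<Longrightarrow> lorentz (a\<^sub>1 u) (a\<^sub>2 u) = 0"
    and a3: "a\<^sub>3 = (\<lambda>u. wedge3 (a\<^sub>0 u) (a\<^sub>1 u) (a\<^sub>2 u))"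
    and h_smooth: "smooth_on I h\<^sub>1" "smooth_on I h\<^sub>2" "smooth_on I h\<^sub>3"
      "smooth_on I h\<^sub>4" "smooth_on I h\<^sub>5" "smooth_on I h\<^sub>6"
    and a0_deriv: "\<And>u. u \<in> I \<Longrightarrow>
      (a\<^sub>0 has_vector_derivative h\<^sub>1 u *\<^sub>R a\<^sub>1 u + h\<^sub>2 u *\<^sub>R a\<^sub>2 u + h\<^sub>3 u *\<^sub>R a\<^sub>3 u) (at u within I)"
    and a1_deriv: "\<And>u. u \<in> I \<Longrightarrow>
      (a\<^sub>1 has_vector_derivative h\<^sub>1 u *\<^sub>R a\<^sub>0 u + h\<^sub>4 u *\<^sub>R a\<^sub>2 u + h\<^sub>5 u *\<^sub>R a\<^sub>3 u) (at u within I)"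
    and a2_deriv: "\<And>u. u \<in> I \<Longrightarrow>
      (a\<^sub>2 has_vector_derivative h\<^sub>2 u *\<^sub>R a\<^sub>0 u - h\<^sub>4 u *\<^sub>R a\<^sub>1 u + h\<^sub>6 u *\<^sub>R a\<^sub>3 u) (at u within I)"
    and a3_deriv: "\<And>u. u \<in> I \<Longrightarrow>
      (a\<^sub>3 has_vector_derivative h\<^sub>3 u *\<^sub>R a\<^sub>0 u - h\<^sub>5 u *\<^sub>R a\<^sub>1 u - h\<^sub>6 u *\<^sub>R a\<^sub>2 u) (at u within I)"
    and x: "x = (\<lambda>(u, v). a\<^sub>0 u + v *\<^sub>R a\<^sub>1 u + (v\<^sup>2 / 2) *\<^sub>R (a\<^sub>0 u + a\<^sub>2 u))"
    and nu1: "\<nu>\<^sub>1 = (\<lambda>(u, v). a\<^sub>3 u)"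
    and nu2: "\<nu>\<^sub>2 = (\<lambda>(u, v). - (v\<^sup>2 / 2) *\<^sub>R a\<^sub>0 u - v *\<^sub>R a\<^sub>1 u + (1 - v\<^sup>2 / 2) *\<^sub>R a\<^sub>2 u)"
  shows "hyperbolic_gfs (I \<times> UNIV) x \<nu>\<^sub>1 \<nu>\<^sub>2
    \<and> gfs_coefficients (I \<times> UNIV) x \<nu>\<^sub>1 \<nu>\<^sub>2
        (\<lambda>(u, v). v * h\<^sub>1 u - h\<^sub>2 u - v * h\<^sub>4 u)
        (\<lambda>(u, v). (1 + v\<^sup>2 / 2) * h\<^sub>3 u + v * h\<^sub>5 u + v\<^sup>2 / 2 * h\<^sub>6 u)
    \<and> basic_invariants (I \<times> UNIV) (partial_u (I \<times> UNIV)) x \<nu>\<^sub>1 \<nu>\<^sub>2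
        (\<lambda>(u, v). (1 + v\<^sup>2 / 2) * h\<^sub>3 u + v * h\<^sub>5 u + v\<^sup>2 / 2 * h\<^sub>6 u)
        (\<lambda>(u, v). - v * h\<^sub>1 u + h\<^sub>2 u + v * h\<^sub>4 u)
        (\<lambda>(u, v). (v\<^sup>2 / 2 - 1) * h\<^sub>1 u - v * h\<^sub>2 u - v\<^sup>2 / 2 * h\<^sub>4 u)
        (\<lambda>(u, v). v\<^sup>2 / 2 * h\<^sub>3 u + v * h\<^sub>5 u + (v\<^sup>2 / 2 - 1) * h\<^sub>6 u)
        (\<lambda>(u, v). v * h\<^sub>3 u + h\<^sub>5 u + v * h\<^sub>6 u)
        (\<lambda>(u, v). - (v\<^sup>2 / 2) * h\<^sub>1 u + v * h\<^sub>2 u + (1 + v\<^sup>2 / 2) * h\<^sub>4 u)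
    \<and> basic_invariants (I \<times> UNIV) (partial_v (I \<times> UNIV)) x \<nu>\<^sub>1 \<nu>\<^sub>2
        (\<lambda>(u, v). 0)
        (\<lambda>(u, v). 0)
        (\<lambda>(u, v). - 1)
        (\<lambda>(u, v). 0)
        (\<lambda>(u, v). 0)
        (\<lambda>(u, v). 1)"
proof -
  have frame: "lorentz_frame (a\<^sub>0 u) (a\<^sub>1 u) (a\<^sub>2 u)" if "u \<in> I" for u
    using a0_H3[OF that] a1_S31[OF that] a2_S31[OF that] orth01[OF that] orth02[OF that] orth12[OF that]
    by (simp add: lorentz_frame_def H3_def S31_def)
  have xframe: "lorentz_frame (x (u, v)) (\<nu>\<^sub>1 (u, v)) (\<nu>\<^sub>2 (u, v))" if "u \<in> I" for u v
    using horocycle_frame(1)[OF frame[OF that]] by (simp add: x nu1 nu2 a3)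
  have nu3: "nu3 x \<nu>\<^sub>1 \<nu>\<^sub>2 (u, v) = - (a\<^sub>1 u + v *\<^sub>R (a\<^sub>0 u + a\<^sub>2 u))" if "u \<in> I" for u v
    using horocycle_frame(2)[OF frame[OF that]] by (simp add: nu3_def x nu1 nu2 a3)
  have x_H3: "x (u, v) \<in> H3" if "u \<in> I" for u v
  proof (rule H3_if_lorentz_negative)
    show "lorentz (x (u, v)) (x (u, v)) = - 1"
      by (rule lorentz_frameD(1)[OF xframe[OF that]])
    have "lorentz (x (u, v)) (a\<^sub>0 u) = - (1 + v\<^sup>2 / 2)"
      using horocycle_frame(3)[OF frame[OF that]] by (simp add: x)
    then show "lorentz (x (u, v)) (a\<^sub>0 u) < 0"
      by (smt (verit) zero_le_power2 divide_nonneg_pos)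
  qed (rule a0_H3[OF that])
  have a3_smooth: "smooth_on I a\<^sub>3"
  proof (rule smooth_on_if_smooth_vector_derivative)
    show "smooth_on I (\<lambda>u. h\<^sub>3 u *\<^sub>R a\<^sub>0 u - h\<^sub>5 u *\<^sub>R a\<^sub>1 u - h\<^sub>6 u *\<^sub>R a\<^sub>2 u)"
      by (intro smooth_intros a_smooth h_smooth)
  qed (rule a3_deriv)
  note smooth = smooth_intros a_smooth a3_smooth h_smooth

  have u_x: "partial_u (I \<times> UNIV) x (u, v) = (h\<^sub>1 u *\<^sub>R a\<^sub>1 u + h\<^sub>2 u *\<^sub>R a\<^sub>2 u + h\<^sub>3 u *\<^sub>R a\<^sub>3 u)
      + v *\<^sub>R (h\<^sub>1 u *\<^sub>R a\<^sub>0 u + h\<^sub>4 u *\<^sub>R a\<^sub>2 u + h\<^sub>5 u *\<^sub>R a\<^sub>3 u)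
      + (v\<^sup>2 / 2) *\<^sub>R ((h\<^sub>1 u *\<^sub>R a\<^sub>1 u + h\<^sub>2 u *\<^sub>R a\<^sub>2 u + h\<^sub>3 u *\<^sub>R a\<^sub>3 u)
          + (h\<^sub>2 u *\<^sub>R a\<^sub>0 u - h\<^sub>4 u *\<^sub>R a\<^sub>1 u + h\<^sub>6 u *\<^sub>R a\<^sub>3 u))" if "u \<in> I" for u v
    unfolding x
    by (rule partial_u_eqI[OF I that])
      (auto intro!: derivative_eq_intros a0_deriv a1_deriv a2_deriv that)
  have u_nu1: "partial_u (I \<times> UNIV) \<nu>\<^sub>1 (u, v) = h\<^sub>3 u *\<^sub>R a\<^sub>0 u - h\<^sub>5 u *\<^sub>R a\<^sub>1 u - h\<^sub>6 u *\<^sub>R a\<^sub>2 u"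
    if "u \<in> I" for u v
    unfolding nu1 by (rule partial_u_eqI[OF I that]) (simp add: a3_deriv that)
  have u_nu2: "partial_u (I \<times> UNIV) \<nu>\<^sub>2 (u, v) =
      - (v\<^sup>2 / 2) *\<^sub>R (h\<^sub>1 u *\<^sub>R a\<^sub>1 u + h\<^sub>2 u *\<^sub>R a\<^sub>2 u + h\<^sub>3 u *\<^sub>R a\<^sub>3 u)
      - v *\<^sub>R (h\<^sub>1 u *\<^sub>R a\<^sub>0 u + h\<^sub>4 u *\<^sub>R a\<^sub>2 u + h\<^sub>5 u *\<^sub>R a\<^sub>3 u)
      + (1 - v\<^sup>2 / 2) *\<^sub>R (h\<^sub>2 u *\<^sub>R a\<^sub>0 u - h\<^sub>4 u *\<^sub>R a\<^sub>1 u + h\<^sub>6 u *\<^sub>R a\<^sub>3 u)" if "u \<in> I" for u v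
    unfolding nu2
    by (rule partial_u_eqI[OF I that])
      (auto intro!: derivative_eq_intros a0_deriv a1_deriv a2_deriv that)
  have u_nu3: "partial_u (I \<times> UNIV) (nu3 x \<nu>\<^sub>1 \<nu>\<^sub>2) (u, v) =
      - ((h\<^sub>1 u *\<^sub>R a\<^sub>0 u + h\<^sub>4 u *\<^sub>R a\<^sub>2 u + h\<^sub>5 u *\<^sub>R a\<^sub>3 u)
        + v *\<^sub>R ((h\<^sub>1 u *\<^sub>R a\<^sub>1 u + h\<^sub>2 u *\<^sub>R a\<^sub>2 u + h\<^sub>3 u *\<^sub>R a\<^sub>3 u)
          + (h\<^sub>2 u *\<^sub>R a\<^sub>0 u - h\<^sub>4 u *\<^sub>R a\<^sub>1 u + h\<^sub>6 u *\<^sub>R a\<^sub>3 u)))" (is "_ = ?D") if "u \<in> I" for u v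
    \<comment> \<open>The formula for \<open>nu3\<close> holds only over \<open>I\<close>, so it is transferred along derivatives within \<open>I\<close>.\<close>
  proof (rule partial_u_eqI[OF I that])
    have "((\<lambda>s. - (a\<^sub>1 s + v *\<^sub>R (a\<^sub>0 s + a\<^sub>2 s))) has_vector_derivative ?D) (at u within I)"
      by (auto intro!: derivative_eq_intros a0_deriv a1_deriv a2_deriv that)
    then show "((\<lambda>s. nu3 x \<nu>\<^sub>1 \<nu>\<^sub>2 (s, v)) has_vector_derivative ?D) (at u within I)"
      by (rule has_vector_derivative_transform[OF that, rotated]) (simp add: nu3)
  qed

  have v_x: "partial_v (I \<times> UNIV) x (u, v) = a\<^sub>1 u + v *\<^sub>R (a\<^sub>0 u + a\<^sub>2 u)" if "u \<in> I" for u v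
    unfolding x
    by (rule partial_v_eqI[OF that]) (auto intro!: derivative_eq_intros)
  have v_nu1: "partial_v (I \<times> UNIV) \<nu>\<^sub>1 (u, v) = 0" if "u \<in> I" for u v
    unfolding nu1 by (rule partial_v_eqI[OF that]) simp
  have v_nu2: "partial_v (I \<times> UNIV) \<nu>\<^sub>2 (u, v) = - (a\<^sub>1 u + v *\<^sub>R (a\<^sub>0 u + a\<^sub>2 u))" if "u \<in> I" for u v
    unfolding nu2
    by (rule partial_v_eqI[OF that]) (auto intro!: derivative_eq_intros simp: algebra_simps)
  have v_nu3: "partial_v (I \<times> UNIV) (nu3 x \<nu>\<^sub>1 \<nu>\<^sub>2) (u, v) = - (a\<^sub>0 u + a\<^sub>2 u)" if "u \<in> I" for u v
    by (rule partial_v_eqI[OF that]) (auto intro!: derivative_eq_intros simp: nu3 that)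

  have inv_u: "basic_invariants (I \<times> UNIV) (partial_u (I \<times> UNIV)) x \<nu>\<^sub>1 \<nu>\<^sub>2
        (\<lambda>(u, v). (1 + v\<^sup>2 / 2) * h\<^sub>3 u + v * h\<^sub>5 u + v\<^sup>2 / 2 * h\<^sub>6 u)
        (\<lambda>(u, v). - v * h\<^sub>1 u + h\<^sub>2 u + v * h\<^sub>4 u)
        (\<lambda>(u, v). (v\<^sup>2 / 2 - 1) * h\<^sub>1 u - v * h\<^sub>2 u - v\<^sup>2 / 2 * h\<^sub>4 u)
        (\<lambda>(u, v). v\<^sup>2 / 2 * h\<^sub>3 u + v * h\<^sub>5 u + (v\<^sup>2 / 2 - 1) * h\<^sub>6 u)
        (\<lambda>(u, v). v * h\<^sub>3 u + h\<^sub>5 u + v * h\<^sub>6 u)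
        (\<lambda>(u, v). - (v\<^sup>2 / 2) * h\<^sub>1 u + v * h\<^sub>2 u + (1 + v\<^sup>2 / 2) * h\<^sub>4 u)"
    unfolding basic_invariants_def Let_def case_prod_beta'
  proof (intro conjI ballI smooth)
    fix p assume "p \<in> I \<times> (UNIV :: real set)"
    then obtain u v where p: "p = (u, v)" and u: "u \<in> I" by auto
    note S = p prod.sel nu3[OF u] u_x[OF u] u_nu1[OF u] u_nu2[OF u] u_nu3[OF u]
    show "partial_u (I \<times> UNIV) x p =
        ((1 + (snd p)\<^sup>2 / 2) * h\<^sub>3 (fst p) + snd p * h\<^sub>5 (fst p) + (snd p)\<^sup>2 / 2 * h\<^sub>6 (fst p)) *\<^sub>R \<nu>\<^sub>1 p
        + (- snd p * h\<^sub>1 (fst p) + h\<^sub>2 (fst p) + snd p * h\<^sub>4 (fst p)) *\<^sub>R \<nu>\<^sub>2 p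
        + (((snd p)\<^sup>2 / 2 - 1) * h\<^sub>1 (fst p) - snd p * h\<^sub>2 (fst p) - (snd p)\<^sup>2 / 2 * h\<^sub>4 (fst p))
          *\<^sub>R nu3 x \<nu>\<^sub>1 \<nu>\<^sub>2 p"
      unfolding S by (simp add: nu1 nu2 vec_eq_iff field_simps power2_eq_square)
    show "partial_u (I \<times> UNIV) \<nu>\<^sub>1 p =
        ((1 + (snd p)\<^sup>2 / 2) * h\<^sub>3 (fst p) + snd p * h\<^sub>5 (fst p) + (snd p)\<^sup>2 / 2 * h\<^sub>6 (fst p)) *\<^sub>R x p
        + ((snd p)\<^sup>2 / 2 * h\<^sub>3 (fst p) + snd p * h\<^sub>5 (fst p) + ((snd p)\<^sup>2 / 2 - 1) * h\<^sub>6 (fst p)) *\<^sub>R \<nu>\<^sub>2 p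
        + (snd p * h\<^sub>3 (fst p) + h\<^sub>5 (fst p) + snd p * h\<^sub>6 (fst p)) *\<^sub>R nu3 x \<nu>\<^sub>1 \<nu>\<^sub>2 p"
      unfolding S by (simp add: x nu2 vec_eq_iff field_simps power2_eq_square)
    show "partial_u (I \<times> UNIV) \<nu>\<^sub>2 p =
        (- snd p * h\<^sub>1 (fst p) + h\<^sub>2 (fst p) + snd p * h\<^sub>4 (fst p)) *\<^sub>R x p
        - ((snd p)\<^sup>2 / 2 * h\<^sub>3 (fst p) + snd p * h\<^sub>5 (fst p) + ((snd p)\<^sup>2 / 2 - 1) * h\<^sub>6 (fst p)) *\<^sub>R \<nu>\<^sub>1 p
        + (- ((snd p)\<^sup>2 / 2) * h\<^sub>1 (fst p) + snd p * h\<^sub>2 (fst p) + (1 + (snd p)\<^sup>2 / 2) * h\<^sub>4 (fst p))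
          *\<^sub>R nu3 x \<nu>\<^sub>1 \<nu>\<^sub>2 p"
      unfolding S by (simp add: x nu1 vec_eq_iff field_simps power2_eq_square)
    show "partial_u (I \<times> UNIV) (nu3 x \<nu>\<^sub>1 \<nu>\<^sub>2) p =
        (((snd p)\<^sup>2 / 2 - 1) * h\<^sub>1 (fst p) - snd p * h\<^sub>2 (fst p) - (snd p)\<^sup>2 / 2 * h\<^sub>4 (fst p)) *\<^sub>R x p
        - (snd p * h\<^sub>3 (fst p) + h\<^sub>5 (fst p) + snd p * h\<^sub>6 (fst p)) *\<^sub>R \<nu>\<^sub>1 p
        - (- ((snd p)\<^sup>2 / 2) * h\<^sub>1 (fst p) + snd p * h\<^sub>2 (fst p) + (1 + (snd p)\<^sup>2 / 2) * h\<^sub>4 (fst p))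
          *\<^sub>R \<nu>\<^sub>2 p"
      unfolding S by (simp add: x nu1 nu2 vec_eq_iff field_simps power2_eq_square)
  qed

  have inv_v: "basic_invariants (I \<times> UNIV) (partial_v (I \<times> UNIV)) x \<nu>\<^sub>1 \<nu>\<^sub>2
        (\<lambda>(u, v). 0) (\<lambda>(u, v). 0) (\<lambda>(u, v). - 1) (\<lambda>(u, v). 0) (\<lambda>(u, v). 0) (\<lambda>(u, v). 1)"
    unfolding basic_invariants_def Let_def case_prod_beta'
    by (intro conjI ballI smooth_on_const)
      (auto simp: v_x v_nu1 v_nu2 v_nu3 nu3, auto simp: x nu2 algebra_simps)

  have coeffs: "gfs_coefficients (I \<times> UNIV) x \<nu>\<^sub>1 \<nu>\<^sub>2
        (\<lambda>(u, v). v * h\<^sub>1 u - h\<^sub>2 u - v * h\<^sub>4 u)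
        (\<lambda>(u, v). (1 + v\<^sup>2 / 2) * h\<^sub>3 u + v * h\<^sub>5 u + v\<^sup>2 / 2 * h\<^sub>6 u)"
    unfolding gfs_coefficients_def case_prod_beta'
  proof (intro conjI ballI smooth)
    fix p assume pU: "p \<in> I \<times> (UNIV :: real set)"
    then obtain u v where p: "p = (u, v)" and u: "u \<in> I" by auto
    have xu: "partial_u (I \<times> UNIV) x p =
        ((1 + v\<^sup>2 / 2) * h\<^sub>3 u + v * h\<^sub>5 u + v\<^sup>2 / 2 * h\<^sub>6 u) *\<^sub>R \<nu>\<^sub>1 p
        + (- v * h\<^sub>1 u + h\<^sub>2 u + v * h\<^sub>4 u) *\<^sub>R \<nu>\<^sub>2 p
        + ((v\<^sup>2 / 2 - 1) * h\<^sub>1 u - v * h\<^sub>2 u - v\<^sup>2 / 2 * h\<^sub>4 u) *\<^sub>R wedge3 (x p) (\<nu>\<^sub>1 p) (\<nu>\<^sub>2 p)"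
      using inv_u pU unfolding basic_invariants_def Let_def p nu3_def by simp
    have xv: "partial_v (I \<times> UNIV) x p = - wedge3 (x p) (\<nu>\<^sub>1 p) (\<nu>\<^sub>2 p)"
      using nu3[OF u] v_x[OF u] by (simp add: p nu3_def)
    show "wedge3 (x p) (partial_u (I \<times> UNIV) x p) (partial_v (I \<times> UNIV) x p) =
        (snd p * h\<^sub>1 (fst p) - h\<^sub>2 (fst p) - snd p * h\<^sub>4 (fst p)) *\<^sub>R \<nu>\<^sub>1 p
        + ((1 + (snd p)\<^sup>2 / 2) * h\<^sub>3 (fst p) + snd p * h\<^sub>5 (fst p) + (snd p)\<^sup>2 / 2 * h\<^sub>6 (fst p)) *\<^sub>R \<nu>\<^sub>2 p"
      unfolding xu xv wedge3_tangents[OF xframe[OF u, of v], folded p]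
      by (simp add: p algebra_simps)
  qed

  have "smooth_on (I \<times> UNIV) x" "smooth_on (I \<times> UNIV) \<nu>\<^sub>1" "smooth_on (I \<times> UNIV) \<nu>\<^sub>2"
    unfolding x nu1 nu2 case_prod_beta' by (intro smooth)+
  moreover have "x p \<in> H3 \<and> (\<nu>\<^sub>1 p, \<nu>\<^sub>2 p) \<in> Delta5 \<and>
      lorentz (x p) (\<nu>\<^sub>1 p) = 0 \<and> lorentz (x p) (\<nu>\<^sub>2 p) = 0" if "p \<in> I \<times> UNIV" for p
    using that x_H3 xframe by (auto simp: Delta5_def S31_def lorentz_frame_def)
  ultimately have "hyperbolic_gfs (I \<times> UNIV) x \<nu>\<^sub>1 \<nu>\<^sub>2"
    unfolding hyperbolic_gfs_def using coeffs by blast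
  with coeffs inv_u inv_v show ?thesis by blast
qed

end
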